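(* A strictly convex real normed linear space of dimension more than $1$ does not possess any norming order unit.
   Context: Let $X$ be a non-zero real normed linear space and $e \in X$ with $\Vert e \Vert = 1$. We say $e$ is a norming order unit for $X$ if for every $x \in X$: $\Vert 2x - \Vert x \Vert e \Vert \le \Vert x \Vert$ whenever $\Vert 2x - \lambda e \Vert \le \lambda$ for some $\lambda \ge \Vert x \Vert$. A normed linear space is strictly convex if $\Vert \frac{1}{2}(x + y) \Vert < 1$ whenever $\Vert x \Vert = \Vert y \Vert = 1$ and $x \neq y$. The dimension may be infinite. *)

theory Defs
  imports Complex_Main
begin

definition norming_order_unit :: "'a::real_normed_vector \<Rightarrow> bool" where
  "norming_order_unit e \<longleftrightarrow> norm e = 1 \<and>
     (\<forall>x. (\<exists>l::real. l \<ge> norm x \<and> norm (2 *\<^sub>R x - l *\<^sub>R e) \<le> l) \<longrightarrow>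
          norm (2 *\<^sub>R x - norm x *\<^sub>R e) \<le> norm x)"

definition strictly_convex_space :: "'a::real_normed_vector itself \<Rightarrow> bool" where
  "strictly_convex_space _ \<longleftrightarrow>
     (\<forall>x y::'a. norm x = 1 \<and> norm y = 1 \<and> x \<noteq> y \<longrightarrow> norm ((1/2) *\<^sub>R (x + y)) < 1)"

(* Stated through a Hamel basis instead of "dim UNIV > n": the library's dim is
   0 on an infinite-dimensional space. *)
definition dim_more_than :: "'a::real_vector itself \<Rightarrow> nat \<Rightarrow> bool" where
  "dim_more_than _ n \<longleftrightarrow>
     (\<exists>B::'a set. independent B \<and> span B = UNIV \<and> (infinite B \<or> card B > n))"

end

theory Submission imports Defs begin

text \<open>
  If \<open>e\<close> is a norming order unit and \<open>x\<close> is any vector of its cone, that is, any \<open>x\<close> with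
  \<open>\<parallel>2x - \<lambda>e\<parallel> \<le> \<lambda>\<close> for some \<open>\<lambda> \<ge> \<parallel>x\<parallel>\<close>, then \<open>\<lambda>\<close> may be replaced by \<open>\<parallel>x\<parallel>\<close>. After scaling to
  \<open>\<parallel>x\<parallel> = 1\<close>, this exhibits the unit vector \<open>x\<close> as the midpoint of \<open>e\<close> and \<open>2x - e\<close>, both in the
  unit ball; strict convexity forces \<open>x = e\<close>. So the cone is only the ray spanned by \<open>e\<close>
  (\<open>norming_cone_ray\<close>). On the other hand the cone is large: it contains \<open>(\<parallel>y\<parallel>e + y)/2\<close> for
  every vector \<open>y\<close>. Hence every \<open>y\<close> is a multiple of \<open>e\<close>, and the space is one-dimensional.
\<close>

text \<open>
  A unit vector of a strictly convex space is an extreme point of the unit ball, and \<open>x\<close> is the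
  midpoint of \<open>e\<close> and \<open>2x - e\<close>. The triangle inequality puts \<open>2x - e\<close> on the unit sphere itself,
  where strict convexity can be applied to it and \<open>e\<close>.
\<close>

lemma strictly_convex_midpoint_unit:
  fixes e x :: "'a::real_normed_vector"
  assumes "strictly_convex_space TYPE('a)"
    and "norm e = 1" "norm x = 1" "norm (2 *\<^sub>R x - e) \<le> 1"
  shows "x = e"
proof (rule ccontr)
  assume "x \<noteq> e"
  have "2 = norm ((2 *\<^sub>R x - e) + e)"
    using assms by simp
  also have "\<dots> \<le> norm (2 *\<^sub>R x - e) + 1"
    using norm_triangle_ineq[of "2 *\<^sub>R x - e" e] assms by simp
  finally have "norm (2 *\<^sub>R x - e) = 1"
    using assms by simp
  moreover have "2 *\<^sub>R x - e \<noteq> e"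
  proof
    assume "2 *\<^sub>R x - e = e"
    then have "2 *\<^sub>R x = 2 *\<^sub>R e"
      by (simp add: algebra_simps scaleR_2)
    with \<open>x \<noteq> e\<close> show False
      by simp
  qed
  ultimately have "norm ((1/2) *\<^sub>R ((2 *\<^sub>R x - e) + e)) < 1"
    using assms unfolding strictly_convex_space_def by blast
  then show False
    using assms by simp
qed

text \<open>
  The cone of a norming order unit collapses to a ray: the condition on \<open>e\<close> lets \<open>l\<close> be
  replaced by \<open>\<parallel>x\<parallel>\<close>, and division by \<open>\<parallel>x\<parallel>\<close> turns the resulting inequality into one about a
  unit vector.
\<close>

lemma norming_cone_ray:
  fixes e x :: "'a::real_normed_vector"
  assumes "strictly_convex_space TYPE('a)" "norming_order_unit e"
    and "norm x \<le> l" "norm (2 *\<^sub>R x - l *\<^sub>R e) \<le> l"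
  shows "x = norm x *\<^sub>R e"
proof (cases "x = 0")
  case False
  then have pos: "norm x > 0"
    by simp
  define u where "u = x /\<^sub>R norm x"
  have x: "x = norm x *\<^sub>R u"
    using pos by (simp add: u_def)
  have e: "norm e = 1" and "norm (2 *\<^sub>R x - norm x *\<^sub>R e) \<le> norm x"
    using assms unfolding norming_order_unit_def by blast+
  moreover have "2 *\<^sub>R x - norm x *\<^sub>R e = norm x *\<^sub>R (2 *\<^sub>R u - e)"
    using pos by (simp add: u_def scaleR_right_diff_distrib)
  ultimately have "norm (2 *\<^sub>R u - e) \<le> 1"
    using pos by simp
  moreover have "norm u = 1"
    using pos by (simp add: u_def)
  ultimately have "u = e"
    using strictly_convex_midpoint_unit assms(1) e by blast
  with x show ?thesis
    by simp
qed simp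

lemma dim_more_than_1_not_spanned:
  fixes e :: "'a::real_vector"
  assumes "dim_more_than TYPE('a) 1"
  obtains y where "y \<notin> span {e}"
proof -
  obtain B :: "'a set" where B: "independent B" "infinite B \<or> card B > 1"
    using assms unfolding dim_more_than_def by blast
  have "\<not> B \<subseteq> span {e}"
    using independent_span_bound[of "{e}" B] B by auto
  then show thesis
    using that by blast
qed

theorem corollary3p5:
  assumes "strictly_convex_space TYPE('a::real_normed_vector)"
    and "dim_more_than TYPE('a) 1"
  shows "\<not> (\<exists>e::'a. norming_order_unit e)"
proof
  assume "\<exists>e::'a. norming_order_unit e"
  then obtain e :: 'a where e: "norming_order_unit e"
    by blast
  obtain y where y: "y \<notin> span {e}"
    using dim_more_than_1_not_spanned assms(2) by blast
  \<comment> \<open>Solving \<open>2x - \<lambda>e = y\<close> with \<open>\<lambda> = \<parallel>y\<parallel>\<close> places \<open>x\<close> in the cone of \<open>e\<close> but off its ray.\<close>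
  define x where "x = (1/2) *\<^sub>R (norm y *\<^sub>R e + y)"
  have y_eq: "y = 2 *\<^sub>R x - norm y *\<^sub>R e"
    by (simp add: x_def)
  have "norm x \<le> norm y"
    using norm_triangle_ineq[of "norm y *\<^sub>R e" y] e
    by (simp add: x_def norming_order_unit_def)
  then have "x = norm x *\<^sub>R e"
    using norming_cone_ray[OF assms(1) e] y_eq by simp
  then have "x \<in> span {e}"
    by (metis span_base span_scale singletonI)
  then have "2 *\<^sub>R x - norm y *\<^sub>R e \<in> span {e}"
    by (simp add: span_diff span_scale span_base)
  with y y_eq show False
    by simp
qed

end
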